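(* Let $H$ be a transfer Krull monoid over a finite abelian group $G$ and suppose that $\Delta_\rho(H)=\{1\}$. Then there exists a constant $M^*\in\mathbb N_0$ such that every $L\in\mathcal L(H)$ with $\rho(L)=\rho(H)$ has the form \[ L=y+(L'\cup[0,\ell]\cup L''), \] where $y\in\mathbb Z$, $\ell\in\mathbb N_0$, $L'\subset[-M^*,-1]$, and $L''\subset \ell+[1,M^*]$.
   Context: $\mathbb N_0$ is the set of non-negative integers; for integers $a,b$, $[a,b]=\{x\in\mathbb Z:a\le x\le b\}$. The sets $L',L''$ may be empty. Sequences. Let $G$ be an additively written finite abelian group. $\mathcal F(G)$ is the (multiplicatively written) free abelian monoid with basis $G$; its elements are called sequences over $G$. For $S=g_1\cdots g_\ell\in\mathcal F(G)$, $\sigma(S)=g_1+\cdots+g_\ell$ is its sum. $\mathcal B(G)=\{S\in\mathcal F(G):\sigma(S)=0\}$ is the monoid of zero-sum sequences over $G$. Monoids. A monoid is a commutative cancellative semigroup with identity. For a monoid $H$, $H^\times$ is its group of units and $\mathcal A(H)$ its set of atoms (irreducible elements). For a non-unit $a\in H$, $\mathsf L(a)$ is the set of all positive integers $k$ such that $a=u_1\cdots u_k$ with $u_1,\ldots,u_k\in\mathcal A(H)$; for a unit $a$, $\mathsf L(a)=\{0\}$. Put $\mathcal L(H)=\{\mathsf L(a):a\in H\}$. For a finite nonempty set $L$ of positive integers, $\rho(L)=\max L/\min L$, and $\rho(\{0\})=1$. The elasticity of $H$ is $\rho(H)=\sup\{\rho(L):L\in\mathcal L(H)\}$. Transfer Krull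 monoids. A monoid $H$ is a transfer Krull monoid over $G$ if there is a transfer homomorphism $\theta:H\to\mathcal B(G)$, i.e. a surjective monoid homomorphism such that $\theta^{-1}(\{1\})=H^\times$ (where $1$ is the empty sequence) and such that whenever $u\in H$ and $\theta(u)=BC$ with $B,C\in\mathcal B(G)$, there are $v,w\in H$ with $u=vw$, $\theta(v)=B$, $\theta(w)=C$. The set $\Delta_\rho(H)$. $\Delta_\rho(H)$ is the set of all positive integers $d$ with the following property: for every positive integer $k$ there is some $L_k\in\mathcal L(H)$ with $\rho(L_k)=\rho(H)$ which has the form $L_k=y+(L'\cup\{0,d,\ldots,\ell d\}\cup L'')\subset y+d\mathbb Z$, where $y\in\mathbb Z$, $\ell\ge k$, and $L',L''$ are finite (possibly empty) sets of integers with all elements of $L'$ negative ($\max L'<0$) and all elements of $L''$ greater than $\ell d$ ($\min L''>\ell d$). *)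

theory Defs
  imports
    "HOL-Algebra.FiniteProduct"
    "HOL-Algebra.Divisibility"
    "HOL-Library.Multiset"
    "HOL-Library.Extended_Real"
begin

section \<open>Zero-sum sequences\<close>

text \<open>
  Groups are records of HOL-Algebra, hence written multiplicatively: the sum of a sequence is
  the product below, with \<open>count S g\<close> the multiplicity of \<open>g\<close> in \<open>S\<close>, and ``sum zero'' reads
  ``product \<open>\<one>\<close>''. Sequences are multisets, their product is the multiset union \<open>+\<close>, and the
  empty sequence is \<open>{#}\<close>.
\<close>

definition sequences :: "('g, 'm) monoid_scheme \<Rightarrow> 'g multiset set" where
  "sequences G = {S. set_mset S \<subseteq> carrier G}"

definition seq_sum :: "('g, 'm) monoid_scheme \<Rightarrow> 'g multiset \<Rightarrow> 'g" where
  "seq_sum G S = (\<Otimes>\<^bsub>G\<^esub>g\<in>set_mset S. g [^]\<^bsub>G\<^esub> count S g)"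

definition zero_sum_monoid :: "('g, 'm) monoid_scheme \<Rightarrow> 'g multiset monoid" where
  "zero_sum_monoid G =
     \<lparr>carrier = {S \<in> sequences G. seq_sum G S = \<one>\<^bsub>G\<^esub>}, monoid.mult = (+), one = {#}\<rparr>"


section \<open>Sets of lengths and elasticity\<close>

definition atoms :: "('h, 'n) monoid_scheme \<Rightarrow> 'h set" where
  "atoms H = {u \<in> carrier H. irreducible H u}"

definition length_set :: "('h, 'n) monoid_scheme \<Rightarrow> 'h \<Rightarrow> nat set" where
  "length_set H a =
     (if a \<in> Units H then {0}
      else {k. 0 < k \<and>
            (\<exists>us. length us = k \<and> set us \<subseteq> atoms H \<and> foldr (\<otimes>\<^bsub>H\<^esub>) us \<one>\<^bsub>H\<^esub> = a)})"

definition length_system :: "('h, 'n) monoid_scheme \<Rightarrow> nat set set" where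
  "length_system H = length_set H ` carrier H"

text \<open>
  The value is meaningful for \<open>L = {0}\<close> and for finite nonempty sets of positive integers only.
  In a transfer Krull monoid over a finite abelian group all sets of lengths are of this kind.
\<close>

definition set_elasticity :: "nat set \<Rightarrow> real" where
  "set_elasticity L = (if L = {0} then 1 else real (Max L) / real (Min L))"

text \<open>The supremum is taken in the extended reals, since for a general monoid it may be infinite.\<close>

definition elasticity :: "('h, 'n) monoid_scheme \<Rightarrow> ereal" where
  "elasticity H = (SUP L \<in> length_system H. ereal (set_elasticity L))"


section \<open>Transfer Krull monoids\<close>

definition transfer_homomorphism ::
  "('g, 'm) monoid_scheme \<Rightarrow> ('h, 'n) monoid_scheme \<Rightarrow> ('h \<Rightarrow> 'g multiset) \<Rightarrow> bool" where
  "transfer_homomorphism G H \<theta> \<longleftrightarrow>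
     \<theta> \<in> hom H (zero_sum_monoid G) \<and>
     \<theta> \<one>\<^bsub>H\<^esub> = {#} \<and>
     \<theta> ` carrier H = carrier (zero_sum_monoid G) \<and>
     {u \<in> carrier H. \<theta> u = {#}} = Units H \<and>
     (\<forall>u \<in> carrier H. \<forall>B \<in> carrier (zero_sum_monoid G). \<forall>C \<in> carrier (zero_sum_monoid G).
        \<theta> u = B + C \<longrightarrow>
        (\<exists>v \<in> carrier H. \<exists>w \<in> carrier H. u = v \<otimes>\<^bsub>H\<^esub> w \<and> \<theta> v = B \<and> \<theta> w = C))"

definition transfer_krull_monoid ::
  "('g, 'm) monoid_scheme \<Rightarrow> ('h, 'n) monoid_scheme \<Rightarrow> bool" where
  "transfer_krull_monoid G H \<longleftrightarrow>
     comm_monoid_cancel H \<and> (\<exists>\<theta>. transfer_homomorphism G H \<theta>)"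


section \<open>The set of distances attached to maximal elasticity\<close>

definition Delta_rho :: "('h, 'n) monoid_scheme \<Rightarrow> nat set" where
  "Delta_rho H =
     {d. 0 < d \<and>
       (\<forall>k::nat. 0 < k \<longrightarrow>
         (\<exists>L \<in> length_system H. ereal (set_elasticity L) = elasticity H \<and>
           (\<exists>(y::int) (l::nat) (L'::int set) (L''::int set).
              k \<le> l \<and> finite L' \<and> finite L'' \<and>
              (\<forall>x \<in> L'. x < 0) \<and> (\<forall>x \<in> L''. int l * int d < x) \<and>
              int ` L = (+) y ` (L' \<union> (\<lambda>i. int i * int d) ` {0..l} \<union> L'') \<and>
              int ` L \<subseteq> range (\<lambda>z. y + int d * z))))}"

end

theory Submission
  imports Defs
begin

text \<open>
  A transfer homomorphism preserves sets of lengths, so everything happens in the monoid of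
  zero-sum sequences, whose finitely many atoms are multisets. Call \<open>B\<close> extremal if \<open>L(B)\<close> has
  maximal elasticity \<open>\<rho>\<close>; then minimal and maximal lengths are additive on extremal elements. If
  \<open>L(B)\<close> is not a singleton, the differences of lengths of the powers of \<open>B\<close> form a subgroup
  \<open>d\<int>\<close>, and \<open>d\<close> lies in \<open>\<Delta>\<^sub>\<rho>(H) = {1}\<close>. Hence some power of \<open>B\<close> has two consecutive lengths,
  and therefore \<open>L(B\<^sup>m)\<close> contains all integers between its minimum and its maximum except for a
  part near the ends that is bounded independently of \<open>m\<close>. By Dickson's lemma, applied to pairs
  of factorizations with length ratio \<open>\<rho>\<close>, the extremal elements are generated by finitely many
  of them, and the bounds for the generators add up to a uniform one.
\<close>

section \<open>Dickson's lemma\<close>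

text \<open>Some subsequence is monotone in one direction or the other. A decreasing sequence of
  naturals is constant from the place where it takes its least value, so a tail of it is also
  increasing.\<close>

lemma nat_mono_subseq:
  fixes s :: "nat \<Rightarrow> nat"
  obtains r :: "nat \<Rightarrow> nat" where "strict_mono r" "mono (\<lambda>n. s (r n))"
proof -
  obtain f where f: "strict_mono f" "monoseq (\<lambda>n. s (f n))"
    using seq_monosub by blast
  show thesis
  proof (cases "incseq (\<lambda>n. s (f n))")
    case True
    with f that show thesis by blast
  next
    case False
    with f have dec: "decseq (\<lambda>n. s (f n))" by (simp add: monoseq_iff)
    define v where "v = (LEAST v. \<exists>n. v = s (f n))"
    have "\<exists>N. v = s (f N)"
      unfolding v_def by (rule LeastI) blast
    then obtain N where N: "v = s (f N)" by blast
    have "v \<le> s (f n)" for n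
      unfolding v_def by (rule Least_le) auto
    moreover have "s (f (n + N)) \<le> v" for n
      using decseqD[OF dec, of N "n + N"] N by simp
    ultimately have "s (f (n + N)) = v" for n
      by (simp add: le_antisym)
    moreover have "strict_mono (\<lambda>n. f (n + N))"
      using f(1) by (simp add: strict_mono_def)
    ultimately show thesis
      using that[of "\<lambda>n. f (n + N)"] by (simp add: mono_def)
  qed
qed

text \<open>The coordinates are treated one at a time: thinning out further keeps the coordinates
  already handled monotone.\<close>

lemma dickson_subseq:
  fixes f :: "nat \<Rightarrow> 'a \<Rightarrow> nat"
  assumes "finite A"
  shows "\<exists>r :: nat \<Rightarrow> nat. strict_mono r \<and> (\<forall>a\<in>A. mono (\<lambda>n. f (r n) a))"
  using assms
proof (induction A)
  case empty
  show ?case by (rule exI[of _ id]) (simp add: strict_mono_def)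
next
  case (insert a A)
  then obtain r :: "nat \<Rightarrow> nat" where r: "strict_mono r" "\<forall>a\<in>A. mono (\<lambda>n. f (r n) a)" by blast
  obtain t :: "nat \<Rightarrow> nat" where t: "strict_mono t" "mono (\<lambda>n. f (r (t n)) a)"
    using nat_mono_subseq[of "\<lambda>n. f (r n) a"] by blast
  have "mono t" using t(1) by (rule strict_mono_mono)
  have "mono (\<lambda>n. f (r (t n)) b)" if "b \<in> A" for b
  proof (rule monoI)
    fix m n :: nat assume "m \<le> n"
    then have "t m \<le> t n" using \<open>mono t\<close> by (rule monoD[rotated])
    then show "f (r (t m)) b \<le> f (r (t n)) b"
      using r(2) that monoD[of "\<lambda>n. f (r n) b"] by blast
  qed
  with t(2) have "\<forall>b\<in>insert a A. mono (\<lambda>n. f (r (t n)) b)" by blast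
  moreover have "strict_mono (\<lambda>n. r (t n))"
    using r(1) t(1) by (simp add: strict_mono_def)
  ultimately show ?case by blast
qed

text \<open>An infinite antichain would contain an injective sequence, and the first two terms of
  its monotone subsequence would be comparable. It serves twice: for atoms, with group elements as
  coordinates, and for pairs of factorizations, with atoms as coordinates.\<close>

lemma dickson_finite_antichain:
  fixes f :: "'b \<Rightarrow> 'a \<Rightarrow> nat"
  assumes "finite A"
    and antichain: "\<And>x y. x \<in> S \<Longrightarrow> y \<in> S \<Longrightarrow> (\<forall>a\<in>A. f x a \<le> f y a) \<Longrightarrow> x = y"
  shows "finite S"
proof (rule ccontr)
  assume "infinite S"
  then obtain g :: "nat \<Rightarrow> 'b" where g: "inj g" "range g \<subseteq> S"
    using infinite_countable_subset by blast
  obtain r :: "nat \<Rightarrow> nat" where r: "strict_mono r" "\<forall>a\<in>A. mono (\<lambda>n. f (g (r n)) a)"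
    using dickson_subseq[OF assms(1), of "\<lambda>n. f (g n)"] by blast
  have "\<forall>a\<in>A. f (g (r 0)) a \<le> f (g (r 1)) a"
    using r(2) monoD[of "\<lambda>n. f (g (r n)) _" 0 1] by blast
  with g(2) have "g (r 0) = g (r 1)" by (intro antichain) auto
  with g(1) have "r 0 = r 1" by (simp add: inj_eq)
  with r(1) show False by (simp add: strict_mono_eq)
qed


section \<open>Lengths of factorizations in monoids of multisets\<close>

text \<open>A factorization is a multiset of members of \<open>A\<close>, so the order of factors is
  disregarded. The set is empty when \<open>B\<close> has no factorization.\<close>

definition mset_lengths :: "'a multiset set \<Rightarrow> 'a multiset \<Rightarrow> nat set" where
  "mset_lengths A B = {size X | X. set_mset X \<subseteq> A \<and> \<Sum>\<^sub># X = B}"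

lemma mset_lengthsI: "set_mset X \<subseteq> A \<Longrightarrow> \<Sum>\<^sub># X = B \<Longrightarrow> size X \<in> mset_lengths A B"
  by (auto simp: mset_lengths_def)

lemma mset_lengths_add:
  assumes "k \<in> mset_lengths A B" "l \<in> mset_lengths A C"
  shows "k + l \<in> mset_lengths A (B + C)"
proof -
  obtain X Y where "set_mset X \<subseteq> A" "\<Sum>\<^sub># X = B" "k = size X" "set_mset Y \<subseteq> A" "\<Sum>\<^sub># Y = C" "l = size Y"
    using assms by (auto simp: mset_lengths_def)
  then show ?thesis using mset_lengthsI[of "X + Y" A "B + C"] by simp
qed

lemma zero_in_mset_lengths: "0 \<in> mset_lengths A {#}"
  using mset_lengthsI[of "{#}" A] by simp

lemma mset_lengths_repeat:
  assumes "k \<in> mset_lengths A B"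
  shows "n * k \<in> mset_lengths A (repeat_mset n B)"
proof (induction n)
  case (Suc n)
  with assms mset_lengths_add[of k A B "n * k" "repeat_mset n B"] show ?case by simp
qed (simp add: zero_in_mset_lengths)

lemma size_le_size_sum_mset:
  assumes "{#} \<notin># X"
  shows "size X \<le> size (\<Sum>\<^sub># X)"
  using assms
proof (induction X)
  case (add B X)
  then have "size B > 0" by (auto simp: nonempty_has_size[symmetric])
  with add show ?case by auto
qed simp

lemma finite_mset_lengths:
  assumes "{#} \<notin> A"
  shows "finite (mset_lengths A B)"
proof (rule finite_subset)
  show "mset_lengths A B \<subseteq> {..size B}"
  proof
    fix k assume "k \<in> mset_lengths A B"
    then obtain X where "set_mset X \<subseteq> A" "\<Sum>\<^sub># X = B" "k = size X"
      by (auto simp: mset_lengths_def)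
    then show "k \<in> {..size B}" using assms size_le_size_sum_mset[of X] by auto
  qed
qed simp

lemma mset_lengths_empty:
  assumes "{#} \<notin> A"
  shows "mset_lengths A {#} = {0}"
proof (intro subset_antisym subsetI)
  fix k assume "k \<in> mset_lengths A {#}"
  then obtain X where X: "set_mset X \<subseteq> A" "\<Sum>\<^sub># X = {#}" "k = size X"
    by (auto simp: mset_lengths_def)
  then have "{#} \<notin># X" using assms by blast
  then have "size X \<le> size (\<Sum>\<^sub># X)" by (rule size_le_size_sum_mset)
  then show "k \<in> {0}" unfolding X(2,3) by simp
qed (simp add: zero_in_mset_lengths)

lemma zero_in_mset_lengths_iff: "0 \<in> mset_lengths A B \<longleftrightarrow> B = {#}"
proof
  assume "0 \<in> mset_lengths A B"
  then obtain X where "\<Sum>\<^sub># X = B" "0 = size X" by (auto simp: mset_lengths_def)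
  then show "B = {#}" by auto
qed (simp add: zero_in_mset_lengths)

text \<open>Of the \<open>n\<close> copies of \<open>B\<close>, use the longer factorization in
  exactly \<open>j\<close>.\<close>

lemma mset_lengths_progression:
  assumes "s \<in> mset_lengths A B" "s + d \<in> mset_lengths A B" "j \<le> n"
  shows "n * s + j * d \<in> mset_lengths A (repeat_mset n B)"
proof -
  obtain i where n: "n = j + i" using assms(3) le_Suc_ex by blast
  have "j * (s + d) + i * s \<in> mset_lengths A (repeat_mset j B + repeat_mset i B)"
    by (intro mset_lengths_add mset_lengths_repeat assms)
  then show ?thesis by (simp add: n repeat_mset_distrib algebra_simps)
qed


section \<open>Elements of maximal elasticity\<close>

text \<open>The elasticity bound is written without division, so that it covers the empty multiset,
  whose only length is 0.\<close>

locale bounded_elasticity =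
  fixes A :: "'a multiset set" and \<rho> :: real
  assumes finite_A: "finite A"
    and empty_notin_A: "{#} \<notin> A"
    and rho_ge_1: "1 \<le> \<rho>"
    and length_bound: "k \<in> mset_lengths A B \<Longrightarrow> l \<in> mset_lengths A B \<Longrightarrow> real l \<le> \<rho> * real k"
begin

abbreviation Len :: "'a multiset \<Rightarrow> nat set" where "Len \<equiv> mset_lengths A"

text \<open>In this product form the empty multiset is extremal for every \<open>\<rho>\<close>, so
  it can serve as the identity among the extremal elements.\<close>

definition extremal :: "'a multiset \<Rightarrow> bool" where
  "extremal B \<longleftrightarrow> Len B \<noteq> {} \<and> real (Max (Len B)) = \<rho> * real (Min (Len B))"

lemma finite_Len: "finite (Len B)"
  using finite_mset_lengths empty_notin_A .

lemma Min_Len: "Len B \<noteq> {} \<Longrightarrow> Min (Len B) \<in> Len B"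
  and Max_Len: "Len B \<noteq> {} \<Longrightarrow> Max (Len B) \<in> Len B"
  and Min_Len_le: "k \<in> Len B \<Longrightarrow> Min (Len B) \<le> k"
  and Max_Len_ge: "k \<in> Len B \<Longrightarrow> k \<le> Max (Len B)"
  using finite_Len by auto

lemma extremal_Min: "extremal B \<Longrightarrow> Min (Len B) \<in> Len B"
  and extremal_Max: "extremal B \<Longrightarrow> Max (Len B) \<in> Len B"
  by (auto simp: extremal_def Min_Len Max_Len)

text \<open>By \<open>length_bound\<close>, a shorter or a longer factorization would push the ratio
  above \<open>\<rho>\<close>. Hence two lengths with ratio exactly \<open>\<rho>\<close> must be
  the extreme ones.\<close>

lemma extremalI:
  assumes "k \<in> Len B" "l \<in> Len B" "real l = \<rho> * real k"
  shows "extremal B" "Min (Len B) = k" "Max (Len B) = l"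
proof -
  have ne: "Len B \<noteq> {}" using assms by auto
  have "real (Max (Len B)) \<le> \<rho> * real k"
    using length_bound[OF assms(1) Max_Len[OF ne]] .
  with assms(3) show l: "Max (Len B) = l"
    using Max_Len_ge[OF assms(2)] by simp
  have "\<rho> * real k \<le> \<rho> * real (Min (Len B))"
    using length_bound[OF Min_Len[OF ne] assms(2)] assms(3) by simp
  then have "k \<le> Min (Len B)" using rho_ge_1 by simp
  then show k: "Min (Len B) = k" using Min_Len_le[OF assms(1)] by simp
  show "extremal B" using ne k l assms(3) by (simp add: extremal_def)
qed

text \<open>The sums of the minima and of the maxima are lengths of \<open>B + C\<close> with ratio
  \<open>\<rho>\<close>, so \<open>extremalI\<close> identifies them as the extreme lengths.\<close>

lemma extremal_add:
  assumes "extremal B" "extremal C"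
  shows "extremal (B + C)"
    and "Min (Len (B + C)) = Min (Len B) + Min (Len C)"
    and "Max (Len (B + C)) = Max (Len B) + Max (Len C)"
proof -
  have "real (Max (Len B) + Max (Len C)) = \<rho> * real (Min (Len B) + Min (Len C))"
    using assms by (simp add: extremal_def algebra_simps)
  note * = extremalI[OF mset_lengths_add[OF extremal_Min[OF assms(1)] extremal_Min[OF assms(2)]]
    mset_lengths_add[OF extremal_Max[OF assms(1)] extremal_Max[OF assms(2)]] this]
  show "extremal (B + C)"
    and "Min (Len (B + C)) = Min (Len B) + Min (Len C)"
    and "Max (Len (B + C)) = Max (Len B) + Max (Len C)"
    by (fact *)+
qed

lemma extremal_empty: "extremal {#}"
  using extremalI(1)[OF zero_in_mset_lengths zero_in_mset_lengths] by simp

lemma extremal_repeat: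
  assumes "extremal B"
  shows "extremal (repeat_mset n B)"
    and "Min (Len (repeat_mset n B)) = n * Min (Len B)"
    and "Max (Len (repeat_mset n B)) = n * Max (Len B)"
proof -
  have "real (n * Max (Len B)) = \<rho> * real (n * Min (Len B))"
    using assms by (simp add: extremal_def)
  note * = extremalI[OF mset_lengths_repeat[OF extremal_Min[OF assms]]
    mset_lengths_repeat[OF extremal_Max[OF assms]] this]
  show "extremal (repeat_mset n B)"
    and "Min (Len (repeat_mset n B)) = n * Min (Len B)"
    and "Max (Len (repeat_mset n B)) = n * Max (Len B)"
    by (fact *)+
qed

section \<open>Finite generation of the extremal elements\<close>

definition extremal_pairs :: "('a multiset multiset \<times> 'a multiset multiset) set" where
  "extremal_pairs = {(X, Y). set_mset X \<subseteq> A \<and> set_mset Y \<subseteq> A \<and> \<Sum>\<^sub># X = \<Sum>\<^sub># Y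
     \<and> real (size Y) = \<rho> * real (size X)}"

text \<open>Equality of sums and the length ratio are both linear conditions, so they survive
  cancellation. This is the reason for working with pairs of factorizations, which can be subtracted
  componentwise.\<close>

lemma extremal_pairs_diff:
  assumes "(X, Y) \<in> extremal_pairs" "(X', Y') \<in> extremal_pairs" "X' \<subseteq># X" "Y' \<subseteq># Y"
  shows "(X - X', Y - Y') \<in> extremal_pairs"
proof -
  obtain X1 Y1 where X1: "X = X' + X1" and Y1: "Y = Y' + Y1"
    using assms(3,4) by (auto simp: mset_subset_eq_exists_conv)
  show ?thesis
    using assms(1,2) unfolding X1 Y1 extremal_pairs_def by (auto simp: algebra_simps)
qed

text \<open>Pairs consisting of a shortest and a longest factorization form a monoid given by linear
  equations, so Dickson's lemma yields finitely many generators.\<close>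

lemma extremal_finitely_generated:
  obtains F where "finite F" "\<And>C. C \<in> F \<Longrightarrow> extremal C"
    "\<And>B. extremal B \<Longrightarrow> \<exists>W. set_mset W \<subseteq> F \<and> \<Sum>\<^sub># W = B"
proof -
  define P where "P = extremal_pairs - {({#}, {#})}"
  \<comment> \<open>The minimal nontrivial pairs, for the componentwise order.\<close>
  define P0 where "P0 = {(X, Y) \<in> P. \<forall>(X', Y') \<in> P. X' \<subseteq># X \<longrightarrow> Y' \<subseteq># Y \<longrightarrow> X' = X \<and> Y' = Y}"
  have "finite P0"
  proof (rule dickson_finite_antichain)
    \<comment> \<open>A pair is a vector of multiplicities with one block of coordinates for each
      factorization.\<close>
    show "finite (A <+> A)" using finite_A by simp
  next
    fix p q assume pq: "p \<in> P0" "q \<in> P0"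
      and le: "\<forall>a\<in>A <+> A. case_sum (count (fst p)) (count (snd p)) a
                             \<le> case_sum (count (fst q)) (count (snd q)) a"
    obtain X Y X' Y' where [simp]: "p = (X, Y)" "q = (X', Y')" by (cases p, cases q)
    have *: "set_mset X \<subseteq> A" "set_mset Y \<subseteq> A"
      using pq by (auto simp: P0_def P_def extremal_pairs_def)
    have "count X a \<le> count X' a" for a
      using le[rule_format, of "Inl a"] * by (cases "a \<in># X") (auto simp: not_in_iff)
    moreover have "count Y a \<le> count Y' a" for a
      using le[rule_format, of "Inr a"] * by (cases "a \<in># Y") (auto simp: not_in_iff)
    ultimately have "X \<subseteq># X'" "Y \<subseteq># Y'" by (auto simp: subseteq_mset_def)
    then show "p = q" using pq by (auto simp: P0_def)
  qed
  define F where "F = (\<lambda>(X, Y). \<Sum>\<^sub># X) ` P0"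
  have below: "\<exists>(X', Y') \<in> P0. X' \<subseteq># X \<and> Y' \<subseteq># Y" if "(X, Y) \<in> P" for X Y
    using that
  proof (induction "size X + size Y" arbitrary: X Y rule: less_induct)
    case less
    show ?case
    proof (cases "(X, Y) \<in> P0")
      case False
      with less.prems obtain X' Y' where XY': "(X', Y') \<in> P" "X' \<subseteq># X" "Y' \<subseteq># Y" "X' \<noteq> X \<or> Y' \<noteq> Y"
        by (auto simp: P0_def)
      then have "size X' + size Y' < size X + size Y"
        by (metis add_le_less_mono add_less_le_mono mset_subset_size size_mset_mono
            subset_mset.le_imp_less_or_eq)
      from less.hyps[OF this XY'(1)] show ?thesis
        using XY'(2,3) by (auto intro: subset_mset.order_trans)
    qed auto
  qed
  \<comment> \<open>Descent on total size: subtract a minimal pair below the given one and decompose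
    the remainder.\<close>
  have gen: "\<exists>W. set_mset W \<subseteq> F \<and> \<Sum>\<^sub># W = \<Sum>\<^sub># X" if "(X, Y) \<in> extremal_pairs" for X Y
    using that
  proof (induction "size X + size Y" arbitrary: X Y rule: less_induct)
    case less
    show ?case
    proof (cases "(X, Y) \<in> P")
      case True
      then obtain X' Y' where XY': "(X', Y') \<in> P0" "X' \<subseteq># X" "Y' \<subseteq># Y"
        using below by blast
      then have e: "(X', Y') \<in> extremal_pairs" and "X' \<noteq> {#} \<or> Y' \<noteq> {#}"
        by (auto simp: P0_def P_def)
      then have "size X' \<noteq> 0 \<or> size Y' \<noteq> 0" by simp
      then have "size X' + size Y' > 0" by linarith
      moreover have "size X' \<le> size X" "size Y' \<le> size Y"
        using XY' by (auto intro: size_mset_mono)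
      moreover have "size (X - X') = size X - size X'" "size (Y - Y') = size Y - size Y'"
        using XY' by (simp_all add: size_Diff_submset)
      ultimately have "size (X - X') + size (Y - Y') < size X + size Y"
        by linarith
      from less.hyps[OF this extremal_pairs_diff[OF less.prems e XY'(2,3)]]
      obtain W where "set_mset W \<subseteq> F" "\<Sum>\<^sub># W = \<Sum>\<^sub># (X - X')" by blast
      moreover have "\<Sum>\<^sub># X = \<Sum>\<^sub># X' + \<Sum>\<^sub># (X - X')"
        using XY'(2) by (metis subset_mset.add_diff_inverse sum_mset.union)
      moreover have "\<Sum>\<^sub># X' \<in> F" using XY'(1) by (force simp: F_def)
      ultimately show ?thesis
        by (intro exI[of _ "add_mset (\<Sum>\<^sub># X') W"]) auto
    next
      case False
      with less.prems have "X = {#}" by (auto simp: P_def)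
      then show ?thesis by (intro exI[of _ "{#}"]) auto
    qed
  qed
  show thesis
  proof (rule that)
    show "finite F" using \<open>finite P0\<close> by (simp add: F_def)
  next
    fix C assume "C \<in> F"
    then obtain X Y where "(X, Y) \<in> extremal_pairs" "C = \<Sum>\<^sub># X"
      by (auto simp: F_def P0_def P_def)
    then show "extremal C"
      by (intro extremalI(1)[of "size X" _ "size Y"] mset_lengthsI) (auto simp: extremal_pairs_def)
  next
    fix B assume B: "extremal B"
    obtain X Y where "set_mset X \<subseteq> A" "\<Sum>\<^sub># X = B" "size X = Min (Len B)"
        "set_mset Y \<subseteq> A" "\<Sum>\<^sub># Y = B" "size Y = Max (Len B)"
      using extremal_Min[OF B] extremal_Max[OF B] unfolding mset_lengths_def
      by (smt (verit) mem_Collect_eq)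
    then show "\<exists>W. set_mset W \<subseteq> F \<and> \<Sum>\<^sub># W = B"
      using gen[of X Y] B by (auto simp: extremal_pairs_def extremal_def)
  qed
qed

section \<open>Length sets without gaps away from their ends\<close>

definition filled :: "nat \<Rightarrow> 'a multiset \<Rightarrow> bool" where
  "filled M B \<longleftrightarrow> (\<forall>x. Min (Len B) + M \<le> x \<longrightarrow> x + M \<le> Max (Len B) \<longrightarrow> x \<in> Len B)"

text \<open>Two nonempty intervals of integers add up to an interval. The factor 2 pays for the case
  that one length set is too short for its condition to say anything: then its minimum is used
  alone, at a loss of less than twice its margin at the upper end.\<close>

lemma filled_add:
  assumes B: "extremal B" "filled M B" and C: "extremal C" "filled N C"
  shows "filled (2 * M + 2 * N) (B + C)"
  unfolding filled_def
proof (intro allI impI)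
  fix x
  let ?b = "Min (Len B)" and ?b' = "Max (Len B)" and ?c = "Min (Len C)" and ?c' = "Max (Len C)"
  assume "Min (Len (B + C)) + (2 * M + 2 * N) \<le> x" "x + (2 * M + 2 * N) \<le> Max (Len (B + C))"
  then have x: "?b + ?c + 2 * M + 2 * N \<le> x" "x + 2 * M + 2 * N \<le> ?b' + ?c'"
    using extremal_add[OF B(1) C(1)] by auto
  have "\<exists>u v. u \<in> Len B \<and> v \<in> Len C \<and> x = u + v"
  proof -
    \<comment> \<open>Cases 1 and 2: one central interval is empty. Cases 3 and 4: first
      \<open>u\<close> runs through the central interval of \<open>B\<close> with \<open>v\<close>
      at its lower end, then \<open>u\<close> stays at its upper end and \<open>v\<close>
      runs.\<close>
    consider "?b' < ?b + 2 * M" | "?c' < ?c + 2 * N"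
      | "?b + 2 * M \<le> ?b'" "?c + 2 * N \<le> ?c'" "x \<le> ?b' - M + (?c + N)"
      | "?b + 2 * M \<le> ?b'" "?c + 2 * N \<le> ?c'" "?b' - M + (?c + N) < x"
      by linarith
    then show ?thesis
    proof cases
      case 1
      then have "x - ?b \<in> Len C" using x C(2) by (simp add: filled_def)
      then show ?thesis using extremal_Min[OF B(1)] x by (intro exI[of _ ?b] exI[of _ "x - ?b"]) auto
    next
      case 2
      then have "x - ?c \<in> Len B" using x B(2) by (simp add: filled_def)
      then show ?thesis using extremal_Min[OF C(1)] x by (intro exI[of _ "x - ?c"] exI[of _ ?c]) auto
    next
      case 3
      then have "?c + N \<in> Len C" "x - (?c + N) \<in> Len B"
        using x B(2) C(2) by (auto simp: filled_def)
      then show ?thesis using x by (intro exI[of _ "x - (?c + N)"] exI[of _ "?c + N"]) auto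
    next
      case 4
      then have "?b' - M \<in> Len B" "x - (?b' - M) \<in> Len C"
        using x B(2) C(2) by (auto simp: filled_def)
      then show ?thesis using 4 by (intro exI[of _ "?b' - M"] exI[of _ "x - (?b' - M)"]) auto
    qed
  qed
  then show "x \<in> Len (B + C)" using mset_lengths_add by blast
qed

text \<open>Every power has a single length, so margin 1 makes the condition vacuous.\<close>

lemma filled_repeat_trivial:
  assumes B: "extremal B" "\<not> Min (Len B) < Max (Len B)"
  shows "filled 1 (repeat_mset m B)"
proof -
  have "Min (Len B) \<le> Max (Len B)"
    using extremal_Max[OF B(1)] Min_Len_le by blast
  with B(2) have "Min (Len B) = Max (Len B)" by simp
  then show ?thesis
    using extremal_repeat[OF B(1), of m] by (simp add: filled_def)
qed

text \<open>Two consecutive lengths of \<open>K \<cdot> B\<close> produce a full interval of length \<open>h = Max - Min\<close> in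
  \<open>h K \<cdot> B\<close>, and each further factor \<open>B\<close> prolongs it by \<open>h\<close>.\<close>

lemma filled_repeat:
  assumes B: "extremal B" and s: "s \<in> Len (repeat_mset K B)" "Suc s \<in> Len (repeat_mset K B)"
  shows "\<exists>M. \<forall>m. filled M (repeat_mset m B)"
proof (cases "Min (Len B) < Max (Len B)")
  case False
  then show ?thesis using filled_repeat_trivial[OF B] by blast
next
  case True
  define a b h where "a = Min (Len B)" and "b = Max (Len B)" and "h = b - a"
  have h: "0 < h" "b = a + h" using True by (auto simp: h_def a_def b_def)
  have ab: "a \<in> Len B" "a + h \<in> Len B"
    using extremal_Min[OF B] extremal_Max[OF B] h by (auto simp: a_def b_def)
  \<comment> \<open>Write \<open>z\<close> by division with remainder by \<open>h\<close>: the
    remainder is reached in unit steps inside \<open>h\<close> copies of the \<open>K\<close>-th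
    power, the quotient in steps of \<open>h\<close> inside \<open>t\<close> copies of
    \<open>B\<close>.\<close>
  have run: "h * s + t * a + z \<in> Len (repeat_mset (h * K + t) B)" if "z \<le> t * h" for t z
  proof -
    have "h * s + (z mod h) * 1 \<in> Len (repeat_mset h (repeat_mset K B))"
      using s h by (intro mset_lengths_progression) auto
    moreover have "t * a + (z div h) * h \<in> Len (repeat_mset t B)"
      using div_le_mono[OF that, of h] h ab by (intro mset_lengths_progression) simp_all
    ultimately have "(h * s + (z mod h) * 1) + (t * a + (z div h) * h)
        \<in> Len (repeat_mset h (repeat_mset K B) + repeat_mset t B)"
      by (rule mset_lengths_add)
    moreover have "(h * s + (z mod h) * 1) + (t * a + (z div h) * h) = h * s + t * a + z"
      by simp
    moreover have "repeat_mset h (repeat_mset K B) + repeat_mset t B = repeat_mset (h * K + t) B"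
      by (simp add: repeat_mset_distrib)
    ultimately show ?thesis by metis
  qed
  \<comment> \<open>The term \<open>h * s\<close> places \<open>x\<close> above the start of the
    run; \<open>h * K * b\<close> forces \<open>h * K \<le> m\<close> and absorbs the share of these
    copies in the maximum \<open>m * b\<close>.\<close>
  define M where "M = h * s + h * K * b"
  have "filled M (repeat_mset m B)" for m
    unfolding filled_def
  proof (intro allI impI)
    fix x
    assume "Min (Len (repeat_mset m B)) + M \<le> x" "x + M \<le> Max (Len (repeat_mset m B))"
    then have x: "m * a + M \<le> x" "x + M \<le> m * b"
      using extremal_repeat[OF B, of m] by (auto simp: a_def b_def)
    have "h * K * b \<le> m * b" using x(2) unfolding M_def by linarith
    then have "h * K \<le> m" using h by simp
    then obtain t where t: "m = h * K + t" using le_Suc_ex by blast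
    have "h * s + t * a \<le> x" using x by (simp add: M_def t algebra_simps)
    moreover have "x \<le> h * s + t * a + t * h"
      using x by (simp add: M_def t h(2) algebra_simps)
    ultimately show "x \<in> Len (repeat_mset m B)"
      using run[of "x - (h * s + t * a)" t] t by simp
  qed
  then show ?thesis by blast
qed

lemma extremal_sum_mset:
  assumes "\<And>C. C \<in># W \<Longrightarrow> extremal C"
  shows "extremal (\<Sum>\<^sub># W)"
  using assms by (induction W) (simp_all add: extremal_empty extremal_add(1))

text \<open>The margin must not depend on the multiplicities in \<open>W\<close>. So the induction
  is on \<open>F\<close>: all copies of one generator are collected into a single power, whose
  margin is uniform in the exponent.\<close>

lemma filled_sum_mset:
  assumes "finite F" "\<And>C. C \<in> F \<Longrightarrow> extremal C"
    and "\<And>C. C \<in> F \<Longrightarrow> \<exists>M. \<forall>m. filled M (repeat_mset m C)"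
  shows "\<exists>M. \<forall>W. set_mset W \<subseteq> F \<longrightarrow> filled M (\<Sum>\<^sub># W)"
  using assms
proof (induction F)
  case empty
  have "filled 1 {#}"
    using empty_notin_A by (simp add: filled_def mset_lengths_empty)
  then show ?case by auto
next
  case (insert C F)
  then obtain M where M: "\<And>W. set_mset W \<subseteq> F \<Longrightarrow> filled M (\<Sum>\<^sub># W)" by auto
  obtain N where N: "\<And>m. filled N (repeat_mset m C)" using insert.prems(2)[of C] by auto
  have "filled (2 * N + 2 * M) (\<Sum>\<^sub># W)" if W: "set_mset W \<subseteq> insert C F" for W
  proof -
    let ?V = "filter_mset (\<lambda>D. D \<noteq> C) W"
    have "W = replicate_mset (count W C) C + ?V"
      by (metis filter_eq_replicate_mset multiset_partition)
    moreover have "\<Sum>\<^sub># (replicate_mset n C) = repeat_mset n C" for n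
      by (induction n) auto
    ultimately have "\<Sum>\<^sub># W = repeat_mset (count W C) C + \<Sum>\<^sub># ?V"
      by (metis sum_mset.union)
    moreover have V: "set_mset ?V \<subseteq> F" using W by auto
    moreover have "extremal (\<Sum>\<^sub># ?V)"
      using V insert.prems(1) by (intro extremal_sum_mset) auto
    moreover have "extremal (repeat_mset (count W C) C)"
      using insert.prems(1) by (simp add: extremal_repeat)
    ultimately show ?thesis using filled_add N M by metis
  qed
  then show ?case by blast
qed

text \<open>This reduces the uniform bound to the existence of two consecutive lengths in some
  power, which the hypothesis on \<open>Delta_rho\<close> will provide.\<close>

theorem extremal_filled:
  assumes "\<And>B. extremal B \<Longrightarrow> Min (Len B) < Max (Len B) \<Longrightarrow>
    \<exists>K s. s \<in> Len (repeat_mset K B) \<and> Suc s \<in> Len (repeat_mset K B)"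
  shows "\<exists>M. \<forall>B. extremal B \<longrightarrow> filled M B"
proof -
  obtain F where F: "finite F" "\<And>C. C \<in> F \<Longrightarrow> extremal C"
    "\<And>B. extremal B \<Longrightarrow> \<exists>W. set_mset W \<subseteq> F \<and> \<Sum>\<^sub># W = B"
    using extremal_finitely_generated by blast
  have "\<exists>M. \<forall>m. filled M (repeat_mset m C)" if "C \<in> F" for C
  proof (cases "Min (Len C) < Max (Len C)")
    case True
    with assms F(2) that show ?thesis using filled_repeat by blast
  next
    case False
    then show ?thesis using filled_repeat_trivial F(2) that by blast
  qed
  with filled_sum_mset[OF F(1,2)] F(3) show ?thesis by metis
qed

end


text \<open>The generator is the least positive element: a nonzero remainder modulo it would be a
  smaller one.\<close>

lemma int_subgroup_generator:
  fixes D :: "int set"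
  assumes add: "\<And>a b. a \<in> D \<Longrightarrow> b \<in> D \<Longrightarrow> a + b \<in> D"
    and uminus: "\<And>a. a \<in> D \<Longrightarrow> - a \<in> D"
    and a: "a \<in> D" "a \<noteq> 0"
  obtains d where "0 < d" "int d \<in> D" "\<And>b. b \<in> D \<Longrightarrow> int d dvd b"
proof -
  define d where "d = (LEAST d. 0 < d \<and> int d \<in> D)"
  have "0 < nat \<bar>a\<bar> \<and> int (nat \<bar>a\<bar>) \<in> D" using a uminus by (auto simp: abs_if)
  then have d: "0 < d \<and> int d \<in> D" unfolding d_def by (rule LeastI)
  have zero: "0 \<in> D" using add[OF a(1) uminus[OF a(1)]] by simp
  have nat_mult: "int n * int d \<in> D" for n
  proof (induction n)
    case (Suc n)
    then have "int d + int n * int d \<in> D" using add d by blast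
    then show ?case by (simp add: algebra_simps)
  qed (simp add: zero)
  have mult: "z * int d \<in> D" for z
    using nat_mult[of "nat z"] uminus[OF nat_mult[of "nat (- z)"]] by (cases "0 \<le> z") auto
  have "int d dvd b" if "b \<in> D" for b
  proof (rule ccontr)
    assume "\<not> int d dvd b"
    then have "b mod int d \<noteq> 0" by (simp add: dvd_eq_mod_eq_0)
    moreover have "0 \<le> b mod int d" using d by simp
    ultimately have pos: "0 < b mod int d" by linarith
    have "b + (- (b div int d)) * int d \<in> D" using add that mult by blast
    then have "b mod int d \<in> D" by (simp add: minus_div_mult_eq_mod)
    then have "0 < nat (b mod int d) \<and> int (nat (b mod int d)) \<in> D" using pos by simp
    then have "d \<le> nat (b mod int d)" by (subst d_def) (rule Least_le)
    moreover have "b mod int d < int d" using d by simp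
    ultimately show False using pos by linarith
  qed
  with d that show thesis by blast
qed


section \<open>Zero-sum sequences and transfer homomorphisms\<close>

text \<open>The unit group of the zero-sum monoid is trivial, so irreducibility is expressed with
  \<open>{#}\<close> in place of units.\<close>

definition zero_sum_atoms :: "('g, 'm) monoid_scheme \<Rightarrow> 'g multiset set" where
  "zero_sum_atoms G = {U \<in> carrier (zero_sum_monoid G). U \<noteq> {#} \<and>
     (\<forall>B \<in> carrier (zero_sum_monoid G). \<forall>C \<in> carrier (zero_sum_monoid G).
        U = B + C \<longrightarrow> B = {#} \<or> C = {#})}"

lemma empty_notin_zero_sum_atoms: "{#} \<notin> zero_sum_atoms G"
  by (simp add: zero_sum_atoms_def)

context
  fixes G :: "('g, 'm) monoid_scheme" (structure)
  assumes G: "comm_group G" and fin: "finite (carrier G)"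
begin

interpretation comm_group G by (rule G)

text \<open>An index set independent of \<open>S\<close> makes the sums of different sequences
  comparable term by term.\<close>

lemma seq_sum_conv_carrier:
  assumes "set_mset S \<subseteq> carrier G"
  shows "seq_sum G S = (\<Otimes>g\<in>carrier G. g [^] count S g)"
  unfolding seq_sum_def
proof (rule finprod_mono_neutral_cong_left)
  fix g assume "g \<in> carrier G - set_mset S"
  then have "count S g = 0" by (simp add: count_eq_zero_iff)
  then show "g [^] count S g = \<one>" by simp
qed (use assms fin in auto)

lemma seq_sum_add:
  assumes "set_mset S \<subseteq> carrier G" "set_mset T \<subseteq> carrier G"
  shows "seq_sum G (S + T) = seq_sum G S \<otimes> seq_sum G T"
proof -
  have "seq_sum G (S + T) = (\<Otimes>g\<in>carrier G. g [^] count S g \<otimes> g [^] count T g)"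
    using assms by (subst seq_sum_conv_carrier)
      (auto intro!: finprod_cong' simp: nat_pow_mult simp del: finprod_multf)
  also have "\<dots> = seq_sum G S \<otimes> seq_sum G T"
    unfolding seq_sum_conv_carrier[OF assms(1)] seq_sum_conv_carrier[OF assms(2)]
    by (rule finprod_multf) auto
  finally show ?thesis .
qed

text \<open>Removing a zero-sum part leaves a zero-sum sequence, so divisibility between zero-sum
  sequences is plain containment of multisets.\<close>

lemma zero_sum_monoid_add:
  assumes "B \<in> carrier (zero_sum_monoid G)"
  shows "B + C \<in> carrier (zero_sum_monoid G) \<longleftrightarrow> C \<in> carrier (zero_sum_monoid G)"
proof -
  have "seq_sum G C \<in> carrier G" if "set_mset C \<subseteq> carrier G"
    unfolding seq_sum_def using that by (intro finprod_closed) auto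
  then show ?thesis
    using assms by (auto simp: zero_sum_monoid_def sequences_def seq_sum_add)
qed

text \<open>Atoms form an antichain: if one contains another, the complement has sum zero and must
  be empty.\<close>

lemma finite_zero_sum_atoms: "finite (zero_sum_atoms G)"
proof (rule dickson_finite_antichain[of "carrier G" _ count])
  fix U V assume U: "U \<in> zero_sum_atoms G" and V: "V \<in> zero_sum_atoms G"
    and le: "\<forall>g\<in>carrier G. count U g \<le> count V g"
  have "set_mset U \<subseteq> carrier G"
    using U by (auto simp: zero_sum_atoms_def zero_sum_monoid_def sequences_def)
  then have "count U g \<le> count V g" for g
    using le by (cases "g \<in># U") (auto simp: not_in_iff)
  then have "U \<subseteq># V" by (simp add: subseteq_mset_def)
  then obtain C where C: "V = U + C" by (auto simp: mset_subset_eq_exists_conv)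
  then have "C \<in> carrier (zero_sum_monoid G)"
    using U V zero_sum_monoid_add[of U C] by (auto simp: zero_sum_atoms_def)
  then show "U = V" using U V C by (auto simp: zero_sum_atoms_def)
qed (rule fin)

lemma zero_sum_factorization:
  assumes "B \<in> carrier (zero_sum_monoid G)"
  shows "\<exists>X. set_mset X \<subseteq> zero_sum_atoms G \<and> \<Sum>\<^sub># X = B"
  using assms
proof (induction "size B" arbitrary: B rule: less_induct)
  case less
  consider "B = {#}" | "B \<in> zero_sum_atoms G"
    | C D where "C \<in> carrier (zero_sum_monoid G)" "D \<in> carrier (zero_sum_monoid G)"
        "B = C + D" "C \<noteq> {#}" "D \<noteq> {#}"
    using less.prems by (auto simp: zero_sum_atoms_def)
  then show ?case
  proof cases
    case 1
    then show ?thesis by (intro exI[of _ "{#}"]) auto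
  next
    case 2
    then show ?thesis by (intro exI[of _ "{#B#}"]) auto
  next
    case 3
    then have "size C < size B" "size D < size B" by (auto simp: nonempty_has_size)
    with 3 less.hyps obtain X Y where "set_mset X \<subseteq> zero_sum_atoms G" "\<Sum>\<^sub># X = C"
        "set_mset Y \<subseteq> zero_sum_atoms G" "\<Sum>\<^sub># Y = D" by metis
    with 3 show ?thesis by (intro exI[of _ "X + Y"]) auto
  qed
qed

lemma sum_atoms_zero_sum:
  assumes "set_mset X \<subseteq> zero_sum_atoms G"
  shows "\<Sum>\<^sub># X \<in> carrier (zero_sum_monoid G)"
  using assms
proof (induction X)
  case empty
  show ?case by (simp add: zero_sum_monoid_def sequences_def seq_sum_def)
next
  case (add U X)
  then show ?case by (simp add: zero_sum_monoid_add zero_sum_atoms_def)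
qed

text \<open>With this, nonemptiness of the length set can replace membership in the zero-sum monoid
  in the abstract locale.\<close>

lemma zero_sum_lengths_nonempty_iff:
  "mset_lengths (zero_sum_atoms G) B \<noteq> {} \<longleftrightarrow> B \<in> carrier (zero_sum_monoid G)"
  using zero_sum_factorization sum_atoms_zero_sum unfolding mset_lengths_def by blast

end

section \<open>Transfer homomorphisms preserve sets of lengths\<close>

context
  fixes G :: "('g, 'm) monoid_scheme" and H :: "('h, 'n) monoid_scheme" (structure) and \<theta>
  assumes H: "comm_monoid_cancel H" and \<theta>: "transfer_homomorphism G H \<theta>"
begin

interpretation comm_monoid_cancel H by (rule H)

lemma transfer_mult: "a \<in> carrier H \<Longrightarrow> b \<in> carrier H \<Longrightarrow> \<theta> (a \<otimes> b) = \<theta> a + \<theta> b"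
  using \<theta> by (auto simp: transfer_homomorphism_def hom_def zero_sum_monoid_def)

lemma transfer_closed: "a \<in> carrier H \<Longrightarrow> \<theta> a \<in> carrier (zero_sum_monoid G)"
  using \<theta> by (auto simp: transfer_homomorphism_def)

lemma transfer_unit_iff: "a \<in> carrier H \<Longrightarrow> \<theta> a = {#} \<longleftrightarrow> a \<in> Units H"
  using \<theta> by (auto simp: transfer_homomorphism_def)

lemma transfer_split:
  assumes "a \<in> carrier H" "\<theta> a = B + C"
    "B \<in> carrier (zero_sum_monoid G)" "C \<in> carrier (zero_sum_monoid G)"
  obtains v w where "v \<in> carrier H" "w \<in> carrier H" "a = v \<otimes> w" "\<theta> v = B" "\<theta> w = C"
  using \<theta> assms unfolding transfer_homomorphism_def by blast

text \<open>Decompositions of the image lift by the transfer property, decompositions of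
  \<open>u\<close> map forward, and units correspond exactly to the empty sequence.\<close>

lemma transfer_atom_iff:
  assumes u: "u \<in> carrier H"
  shows "u \<in> atoms H \<longleftrightarrow> \<theta> u \<in> zero_sum_atoms G"
proof
  assume "u \<in> atoms H"
  then have irr: "u \<notin> Units H" "\<And>b. b \<in> carrier H \<Longrightarrow> properfactor H b u \<Longrightarrow> b \<in> Units H"
    by (auto simp: atoms_def irreducible_def)
  have "B = {#} \<or> C = {#}" if BC: "\<theta> u = B + C"
    "B \<in> carrier (zero_sum_monoid G)" "C \<in> carrier (zero_sum_monoid G)" for B C
  proof (rule ccontr)
    assume ne: "\<not> (B = {#} \<or> C = {#})"
    obtain v w where vw: "v \<in> carrier H" "w \<in> carrier H" "u = v \<otimes> w" "\<theta> v = B" "\<theta> w = C"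
      using transfer_split[OF u BC] .
    have "\<not> u divides v"
    proof
      assume "u divides v"
      then obtain z where z: "z \<in> carrier H" "v = u \<otimes> z" by (auto simp: factor_def)
      \<comment> \<open>Cancelling the image of \<open>v\<close> would make the image of
        \<open>w\<close> empty.\<close>
      then have "\<theta> v = \<theta> v + \<theta> w + \<theta> z" using vw u by (metis transfer_mult)
      then show False using vw ne by simp
    qed
    then have "properfactor H v u" using vw by (auto simp: properfactor_def factor_def)
    then have "v \<in> Units H" using irr vw by blast
    then show False using transfer_unit_iff vw ne by blast
  qed
  then show "\<theta> u \<in> zero_sum_atoms G"
    using irr(1) u transfer_closed transfer_unit_iff by (auto simp: zero_sum_atoms_def)
next
  assume at: "\<theta> u \<in> zero_sum_atoms G"
  have "b \<in> Units H" if b: "b \<in> carrier H" "properfactor H b u" for b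
  proof -
    obtain c where c: "c \<in> carrier H" "u = b \<otimes> c" and nd: "\<not> u divides b"
      using b by (auto simp: properfactor_def factor_def)
    have "c \<notin> Units H"
    proof
      assume "c \<in> Units H"
      then have "b = u \<otimes> inv c" using c b by (simp add: m_assoc)
      with nd \<open>c \<in> Units H\<close> show False by (auto simp: factor_def)
    qed
    moreover have "\<theta> b = {#} \<or> \<theta> c = {#}"
      using at c b transfer_mult transfer_closed by (auto simp: zero_sum_atoms_def)
    ultimately show ?thesis using transfer_unit_iff b c by blast
  qed
  moreover have "u \<notin> Units H" using at transfer_unit_iff[OF u] by (auto simp: zero_sum_atoms_def)
  ultimately show "u \<in> atoms H" using u by (auto simp: atoms_def irreducible_def)
qed

lemma transfer_foldr:
  assumes "set us \<subseteq> carrier H"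
  shows "foldr (\<otimes>) us \<one> \<in> carrier H \<and> \<theta> (foldr (\<otimes>) us \<one>) = \<Sum>\<^sub># (mset (map \<theta> us))"
  using assms \<theta> by (induction us) (auto simp: transfer_mult transfer_homomorphism_def)

text \<open>Atoms are split off one by one and the last factor is all that remains, so no stray unit
  is left. For the empty list this would fail: \<open>a\<close> would be some unit, not necessarily
  the identity.\<close>

lemma transfer_lift_factorization:
  assumes "Us \<noteq> []" "set Us \<subseteq> zero_sum_atoms G" "a \<in> carrier H" "\<theta> a = \<Sum>\<^sub># (mset Us)"
    and closed: "\<And>X. set_mset X \<subseteq> zero_sum_atoms G \<Longrightarrow> \<Sum>\<^sub># X \<in> carrier (zero_sum_monoid G)"
  shows "\<exists>us. length us = length Us \<and> set us \<subseteq> atoms H \<and> foldr (\<otimes>) us \<one> = a"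
  using assms(1-4)
proof (induction Us arbitrary: a rule: list_nonempty_induct)
  case (single U)
  then show ?case by (intro exI[of _ "[a]"]) (simp add: transfer_atom_iff)
next
  case (cons U Us)
  have "\<theta> a = U + \<Sum>\<^sub># (mset Us)" using cons.prems by simp
  moreover have "U \<in> carrier (zero_sum_monoid G)" using cons.prems by (simp add: zero_sum_atoms_def)
  moreover have "\<Sum>\<^sub># (mset Us) \<in> carrier (zero_sum_monoid G)" using cons.prems by (intro closed) auto
  ultimately obtain v w where vw: "v \<in> carrier H" "w \<in> carrier H" "a = v \<otimes> w" "\<theta> v = U"
      "\<theta> w = \<Sum>\<^sub># (mset Us)"
    using transfer_split[OF cons.prems(2)] by blast
  then obtain us where "length us = length Us" "set us \<subseteq> atoms H" "foldr (\<otimes>) us \<one> = w"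
    using cons.IH[of w] cons.prems by auto
  moreover have "v \<in> atoms H" using vw cons.prems by (simp add: transfer_atom_iff)
  ultimately show ?case using vw by (intro exI[of _ "v # us"]) simp
qed

lemma length_set_transfer:
  assumes a: "a \<in> carrier H"
    and closed: "\<And>X. set_mset X \<subseteq> zero_sum_atoms G \<Longrightarrow> \<Sum>\<^sub># X \<in> carrier (zero_sum_monoid G)"
  shows "length_set H a = mset_lengths (zero_sum_atoms G) (\<theta> a)"
proof (cases "a \<in> Units H")
  case True
  then show ?thesis
    using transfer_unit_iff[OF a] mset_lengths_empty[OF empty_notin_zero_sum_atoms, of G]
    by (simp add: length_set_def)
next
  case False
  then have ne: "\<theta> a \<noteq> {#}" using transfer_unit_iff[OF a] by simp
  show ?thesis
  proof (intro subset_antisym subsetI)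
    fix k assume "k \<in> length_set H a"
    then obtain us where us: "length us = k" "set us \<subseteq> atoms H" "foldr (\<otimes>) us \<one> = a"
      using False by (auto simp: length_set_def)
    then have "set us \<subseteq> carrier H" by (auto simp: atoms_def)
    then have "\<Sum>\<^sub># (mset (map \<theta> us)) = \<theta> a" using transfer_foldr us(3) by metis
    moreover have "set_mset (mset (map \<theta> us)) \<subseteq> zero_sum_atoms G"
      using us(2) \<open>set us \<subseteq> carrier H\<close> transfer_atom_iff by auto
    ultimately show "k \<in> mset_lengths (zero_sum_atoms G) (\<theta> a)"
      using mset_lengthsI[of "mset (map \<theta> us)"] us(1) by simp
  next
    fix k assume k: "k \<in> mset_lengths (zero_sum_atoms G) (\<theta> a)"
    then obtain X where X: "set_mset X \<subseteq> zero_sum_atoms G" "\<Sum>\<^sub># X = \<theta> a" "k = size X"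
      by (auto simp: mset_lengths_def)
    obtain Us where Us: "mset Us = X" using ex_mset by blast
    have "k \<noteq> 0" using k ne zero_in_mset_lengths_iff by metis
    then have "Us \<noteq> []" using Us X by auto
    then obtain us where "length us = length Us" "set us \<subseteq> atoms H" "foldr (\<otimes>) us \<one> = a"
      using transfer_lift_factorization[OF _ _ a _ closed, of Us] X Us by auto
    moreover have "length Us = k" using Us X by auto
    ultimately show "k \<in> length_set H a"
      using False \<open>k \<noteq> 0\<close> by (auto simp: length_set_def)
  qed
qed

end

lemma transfer_krull_length_system:
  assumes "comm_group G" "finite (carrier G)" "transfer_krull_monoid G H"
  shows "length_system H = mset_lengths (zero_sum_atoms G) ` carrier (zero_sum_monoid G)"
proof -
  obtain \<theta> where H: "comm_monoid_cancel H" and \<theta>: "transfer_homomorphism G H \<theta>"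
    using assms(3) by (auto simp: transfer_krull_monoid_def)
  have "length_system H = (\<lambda>a. mset_lengths (zero_sum_atoms G) (\<theta> a)) ` carrier H"
    unfolding length_system_def
    by (intro image_cong refl length_set_transfer[OF H \<theta>] sum_atoms_zero_sum[OF assms(1,2)])
  also have "\<dots> = mset_lengths (zero_sum_atoms G) ` \<theta> ` carrier H" by (simp add: image_image)
  finally show ?thesis using \<theta> by (simp add: transfer_homomorphism_def)
qed


section \<open>The structure of sets of lengths of maximal elasticity\<close>

text \<open>The conclusion has the shape required in \<open>Delta_rho\<close>, with
  \<open>l = k\<close>. By divisibility, \<open>L\<close> has no further elements between the ends
  of the given progression; those outside it form the two remaining sets.\<close>

lemma progression_decomposition:
  fixes L :: "nat set"
  assumes "finite L" "0 < d" and prog: "\<And>i. i \<le> k \<Longrightarrow> y + i * d \<in> L"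
    and dvd: "\<And>x. x \<in> L \<Longrightarrow> int d dvd int x - int y"
  shows "\<exists>(y::int) (l::nat) (L'::int set) (L''::int set).
              k \<le> l \<and> finite L' \<and> finite L'' \<and>
              (\<forall>x \<in> L'. x < 0) \<and> (\<forall>x \<in> L''. int l * int d < x) \<and>
              int ` L = (+) y ` (L' \<union> (\<lambda>i. int i * int d) ` {0..l} \<union> L'') \<and>
              int ` L \<subseteq> range (\<lambda>z. y + int d * z)"
proof -
  let ?f = "\<lambda>x. int x - int y"
  let ?L' = "{z \<in> ?f ` L. z < 0}" and ?L'' = "{z \<in> ?f ` L. int k * int d < z}"
  have "{z \<in> ?f ` L. 0 \<le> z \<and> z \<le> int k * int d} = (\<lambda>i. int i * int d) ` {0..k}"
  proof (intro subset_antisym subsetI)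
    fix z assume z: "z \<in> {z \<in> ?f ` L. 0 \<le> z \<and> z \<le> int k * int d}"
    then have "int d dvd z" using dvd by auto
    then obtain c where c: "z = int d * c" by (auto simp: dvd_def)
    then have "0 \<le> c" "c \<le> int k" using z assms(2) by (auto simp: zero_le_mult_iff mult.commute)
    then show "z \<in> (\<lambda>i. int i * int d) ` {0..k}" using c by (intro image_eqI[of _ _ "nat c"]) auto
  next
    fix z assume "z \<in> (\<lambda>i. int i * int d) ` {0..k}"
    then obtain i where i: "i \<le> k" "z = int i * int d" by auto
    then have "z = ?f (y + i * d)" by simp
    moreover have "int i * int d \<le> int k * int d" using i by (intro mult_right_mono) auto
    ultimately show "z \<in> {z \<in> ?f ` L. 0 \<le> z \<and> z \<le> int k * int d}"
      using prog[OF i(1)] i(2) by (auto intro!: image_eqI[of _ _ "y + i * d"])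
  qed
  then have "?f ` L = ?L' \<union> (\<lambda>i. int i * int d) ` {0..k} \<union> ?L''"
    by auto
  moreover have "int ` L = (+) (int y) ` ?f ` L" by (simp add: image_image)
  ultimately have "int ` L = (+) (int y) ` (?L' \<union> (\<lambda>i. int i * int d) ` {0..k} \<union> ?L'')" by simp
  moreover have "int ` L \<subseteq> range (\<lambda>z. int y + int d * z)"
  proof clarify
    fix x assume "x \<in> L"
    then obtain c where "int x - int y = int d * c" using dvd by (auto simp: dvd_def)
    then show "int x \<in> range (\<lambda>z. int y + int d * z)" by (intro image_eqI[of _ _ c]) auto
  qed
  ultimately show ?thesis
    using assms(1) by (intro exI[of _ "int y"] exI[of _ k] exI[of _ ?L'] exI[of _ ?L'']) auto
qed

text \<open>The bound is \<open>2 * M\<close> because a length set of diameter below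
  \<open>2 * M\<close> may have no central interval, and then everything is measured from its
  minimum.\<close>

lemma interval_decomposition:
  fixes L :: "nat set"
  assumes "finite L" "L \<noteq> {}"
    and filled: "\<And>x. Min L + M \<le> x \<Longrightarrow> x + M \<le> Max L \<Longrightarrow> x \<in> L"
  shows "\<exists>(y::int) (l::nat) (L'::int set) (L''::int set).
       L' \<subseteq> {- int (2 * M) .. -1} \<and>
       L'' \<subseteq> (+) (int l) ` {1 .. int (2 * M)} \<and>
       int ` L = (+) y ` (L' \<union> {0 .. int l} \<union> L'')"
proof -
  have shift: "\<exists>(y::int) (l::nat) (L'::int set) (L''::int set).
       L' \<subseteq> {- int N .. -1} \<and>
       L'' \<subseteq> (+) (int l) ` {1 .. int N} \<and>
       int ` L = (+) y ` (L' \<union> {0 .. int l} \<union> L'')"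
    if yl: "{y..y + l} \<subseteq> L" "y \<le> Min L + N" "Max L \<le> y + l + N" for y l N
  proof -
    let ?f = "\<lambda>x. int x - int y"
    let ?L' = "{z \<in> ?f ` L. z < 0}" and ?L'' = "{z \<in> ?f ` L. int l < z}"
    have b: "Min L \<le> x \<and> x \<le> Max L" if "x \<in> L" for x using assms(1) that by simp
    have "{0..int l} \<subseteq> ?f ` L"
    proof
      fix z assume z: "z \<in> {0..int l}"
      then have "y + nat z \<in> L" using yl(1) by auto
      then show "z \<in> ?f ` L" using z by (intro image_eqI[of _ _ "y + nat z"]) auto
    qed
    then have "?f ` L = ?L' \<union> {0..int l} \<union> ?L''" by auto
    moreover have "int ` L = (+) (int y) ` ?f ` L" by (simp add: image_image)
    ultimately have "int ` L = (+) (int y) ` (?L' \<union> {0..int l} \<union> ?L'')" by simp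
    moreover have "?L' \<subseteq> {- int N .. -1}" using b yl(2) by force
    moreover have "?L'' \<subseteq> (+) (int l) ` {1 .. int N}"
    proof
      fix z assume z: "z \<in> ?L''"
      then have "z - int l \<in> {1..int N}" using b yl(3) by force
      then show "z \<in> (+) (int l) ` {1 .. int N}" by (intro image_eqI[of _ _ "z - int l"]) auto
    qed
    ultimately show ?thesis by blast
  qed
  show ?thesis
  proof (cases "Min L + 2 * M \<le> Max L")
    case True
    have "{Min L + M..(Min L + M) + (Max L - Min L - 2 * M)} \<subseteq> L"
    proof
      fix x assume "x \<in> {Min L + M..(Min L + M) + (Max L - Min L - 2 * M)}"
      then have "Min L + M \<le> x" "x + M \<le> Max L" using True by auto
      then show "x \<in> L" by (rule filled)
    qed
    then show ?thesis by (rule shift) (use True in auto)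
  next
    case False
    \<comment> \<open>The interval degenerates to the minimum, with \<open>l = 0\<close>.\<close>
    have "{Min L..Min L + 0} \<subseteq> L" using assms by simp
    then show ?thesis by (rule shift) (use False in auto)
  qed
qed

section \<open>Consecutive lengths from the hypothesis on \<open>Delta_rho\<close>, and the
  conclusion\<close>

theorem corollary2p3:
  fixes G :: "('g, 'm) monoid_scheme" and H :: "('h, 'n) monoid_scheme"
  assumes "comm_group G" and "finite (carrier G)"
    and "transfer_krull_monoid G H"
    and "Delta_rho H = {1}"
  shows "\<exists>M::nat. \<forall>L \<in> length_system H.
    ereal (set_elasticity L) = elasticity H \<longrightarrow>
    (\<exists>(y::int) (l::nat) (L'::int set) (L''::int set).
       L' \<subseteq> {- int M .. -1} \<and>
       L'' \<subseteq> (+) (int l) ` {1 .. int M} \<and>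
       int ` L = (+) y ` (L' \<union> {0 .. int l} \<union> L''))"
\<comment> \<open>If the supremum is not attained, the claim is vacuous. Otherwise the elasticity is
  a real number.\<close>
proof (cases "\<exists>L \<in> length_system H. ereal (set_elasticity L) = elasticity H")
  case False
  then show ?thesis by blast
next
  case True
  then obtain L0 where L0: "ereal (set_elasticity L0) = elasticity H" by blast
  define A where "A = zero_sum_atoms G"
  define \<rho> where "\<rho> = set_elasticity L0"
  have sys: "length_system H = mset_lengths A ` carrier (zero_sum_monoid G)"
    unfolding A_def using assms(1-3) by (rule transfer_krull_length_system)
  have A: "finite A" "{#} \<notin> A"
    unfolding A_def using finite_zero_sum_atoms[OF assms(1,2)] empty_notin_zero_sum_atoms by auto
  have carrier_iff: "mset_lengths A B \<noteq> {} \<longleftrightarrow> B \<in> carrier (zero_sum_monoid G)" for B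
    unfolding A_def by (rule zero_sum_lengths_nonempty_iff[OF assms(1,2)])
  have in_sys: "mset_lengths A B \<in> length_system H" if "mset_lengths A B \<noteq> {}" for B
    using that carrier_iff sys by blast
  have elasticity_le: "set_elasticity L \<le> \<rho>" if "L \<in> length_system H" for L
  proof -
    have "ereal (set_elasticity L) \<le> elasticity H"
      unfolding elasticity_def using that by (rule SUP_upper)
    then show ?thesis by (simp add: \<rho>_def flip: L0)
  qed
  \<comment> \<open>Witnessed by the empty sequence, whose length set \<open>{0}\<close> has
    elasticity 1 by convention.\<close>
  have one_le: "1 \<le> \<rho>"
    using elasticity_le[OF in_sys[of "{#}"]] mset_lengths_empty[OF A(2)]
    by (simp add: set_elasticity_def)
  have Min_pos: "0 < Min (mset_lengths A B)" if "mset_lengths A B \<noteq> {}" "B \<noteq> {#}" for B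
    using Min_in[OF finite_mset_lengths[OF A(2)] that(1)] zero_in_mset_lengths_iff[of A B] that(2)
    by (metis gr0I)
  have elasticity_eq: "set_elasticity (mset_lengths A B)
      = real (Max (mset_lengths A B)) / real (Min (mset_lengths A B))"
    if "mset_lengths A B \<noteq> {}" "B \<noteq> {#}" for B
  proof -
    have "mset_lengths A B \<noteq> {0}" using Min_pos[OF that] by (metis Min_singleton less_irrefl)
    then show ?thesis by (simp add: set_elasticity_def)
  qed
  interpret bounded_elasticity A \<rho>
  proof
    fix k l B assume kl: "k \<in> mset_lengths A B" "l \<in> mset_lengths A B"
    then have ne: "mset_lengths A B \<noteq> {}" by auto
    show "real l \<le> \<rho> * real k"
    proof (cases "B = {#}")
      case True
      then show ?thesis using kl mset_lengths_empty[OF A(2)] by simp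
    next
      case False
      have "real (Max (mset_lengths A B)) \<le> \<rho> * real (Min (mset_lengths A B))"
        using elasticity_le[OF in_sys[OF ne]] elasticity_eq[OF ne False] Min_pos[OF ne False]
        by (simp add: field_simps)
      moreover have "l \<le> Max (mset_lengths A B)" "Min (mset_lengths A B) \<le> k"
        using kl finite_mset_lengths[OF A(2)] by auto
      moreover have "\<rho> * real (Min (mset_lengths A B)) \<le> \<rho> * real k"
        using calculation(3) one_le by (intro mult_left_mono) auto
      ultimately show ?thesis by linarith
    qed
  qed (use A one_le in auto)
  \<comment> \<open>The empty sequence is excluded: it is always extremal, while \<open>{0}\<close>
    has elasticity 1, which may be below \<open>\<rho>\<close>.\<close>
  have extremal_iff: "extremal B \<longleftrightarrow> ereal (set_elasticity (Len B)) = elasticity H"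
    if "Len B \<noteq> {}" "B \<noteq> {#}" for B
  proof -
    have "ereal (set_elasticity (Len B)) = elasticity H \<longleftrightarrow> set_elasticity (Len B) = \<rho>"
      by (simp add: \<rho>_def flip: L0)
    then show ?thesis
      using that(1) elasticity_eq[OF that] Min_pos[OF that]
      by (simp add: extremal_def nonzero_divide_eq_eq)
  qed
  have "\<exists>K s. s \<in> Len (repeat_mset K B) \<and> Suc s \<in> Len (repeat_mset K B)"
    if B: "extremal B" and lt: "Min (Len B) < Max (Len B)" for B
  proof -
    define D where "D = {int t - int s | s t. \<exists>K. s \<in> Len (repeat_mset K B) \<and> t \<in> Len (repeat_mset K B)}"
    \<comment> \<open>If the \<open>K\<close>-th power has lengths \<open>s\<close> and
      \<open>s + d\<close>, its \<open>k\<close>-th power contains a progression of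
      \<open>k + 1\<close> terms with difference \<open>d\<close>, and it is still extremal.\<close>
    have in_Delta: "d \<in> Delta_rho H"
      if d: "0 < d" "int d \<in> D" "\<And>b. b \<in> D \<Longrightarrow> int d dvd b" for d
      unfolding Delta_rho_def mem_Collect_eq
    proof (intro conjI allI impI)
      show "0 < d" by (rule d(1))
    next
      fix k :: nat assume "0 < k"
      obtain K s t where st: "int d = int t - int s" "s \<in> Len (repeat_mset K B)"
          "t \<in> Len (repeat_mset K B)"
        using d(2) by (auto simp: D_def)
      then have t: "t = s + d" by simp
      let ?C = "repeat_mset k (repeat_mset K B)"
      have C: "extremal ?C" using B by (intro extremal_repeat)
      then have ne: "Len ?C \<noteq> {}" by (simp add: extremal_def)
      have prog: "k * s + i * d \<in> Len ?C" if "i \<le> k" for i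
        using mset_lengths_progression[OF st(2) _ that] st(3) t by simp
      have "?C \<noteq> {#}"
      proof
        assume "?C = {#}"
        then have "k * s + k * d \<in> {0}" using prog[of k] mset_lengths_empty[OF A(2)] by simp
        with \<open>0 < k\<close> d(1) show False by simp
      qed
      then have max_elasticity: "ereal (set_elasticity (Len ?C)) = elasticity H"
        using extremal_iff ne C by blast
      \<comment> \<open>Both \<open>x\<close> and \<open>k * s\<close> are lengths of the same power
        of \<open>B\<close>, so their difference lies in \<open>D\<close>.\<close>
      have dvd: "int d dvd int x - int (k * s)" if "x \<in> Len ?C" for x
      proof (rule d(3))
        have "k * s \<in> Len (repeat_mset (k * K) B)" "x \<in> Len (repeat_mset (k * K) B)"
          using prog[of 0] that by simp_all
        then show "int x - int (k * s) \<in> D" unfolding D_def by blast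
      qed
      show "\<exists>L \<in> length_system H. ereal (set_elasticity L) = elasticity H \<and>
           (\<exists>(y::int) (l::nat) (L'::int set) (L''::int set).
              k \<le> l \<and> finite L' \<and> finite L'' \<and>
              (\<forall>x \<in> L'. x < 0) \<and> (\<forall>x \<in> L''. int l * int d < x) \<and>
              int ` L = (+) y ` (L' \<union> (\<lambda>i. int i * int d) ` {0..l} \<union> L'') \<and>
              int ` L \<subseteq> range (\<lambda>z. y + int d * z))"
        by (intro bexI[of _ "Len ?C"] conjI in_sys ne max_elasticity)
          (rule progression_decomposition[OF finite_Len d(1) prog dvd])
    qed
    obtain d where d: "0 < d" "int d \<in> D" "\<And>b. b \<in> D \<Longrightarrow> int d dvd b"
    \<comment> \<open>\<open>D\<close> is closed under sums because lengths add when exponents add,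
      and \<open>B\<close> itself provides a nonzero element.\<close>
    proof (rule int_subgroup_generator[of D "int (Max (Len B)) - int (Min (Len B))"])
      fix a b assume "a \<in> D" "b \<in> D"
      then obtain s t K s' t' K' where *: "a = int t - int s" "b = int t' - int s'"
        "s \<in> Len (repeat_mset K B)" "t \<in> Len (repeat_mset K B)"
        "s' \<in> Len (repeat_mset K' B)" "t' \<in> Len (repeat_mset K' B)"
        by (auto simp: D_def)
      have "a + b = int (t + t') - int (s + s')" using * by simp
      moreover have "s + s' \<in> Len (repeat_mset (K + K') B)" "t + t' \<in> Len (repeat_mset (K + K') B)"
        using * mset_lengths_add by (auto simp: repeat_mset_distrib)
      ultimately show "a + b \<in> D" unfolding D_def by blast
    next
      fix a assume "a \<in> D"
      then obtain s t K where "a = int t - int s"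
        "s \<in> Len (repeat_mset K B)" "t \<in> Len (repeat_mset K B)"
        by (auto simp: D_def)
      then have "- a = int s - int t" by simp
      with \<open>s \<in> _\<close> \<open>t \<in> _\<close> show "- a \<in> D" unfolding D_def by blast
    next
      have "Min (Len B) \<in> Len (repeat_mset 1 B)" "Max (Len B) \<in> Len (repeat_mset 1 B)"
        using extremal_Min[OF B] extremal_Max[OF B] by simp_all
      then show "int (Max (Len B)) - int (Min (Len B)) \<in> D" unfolding D_def by blast
    qed (use lt that in auto)
    then have "d = 1" using in_Delta[of d] assms(4) by blast
    then obtain K s t where "int t - int s = 1" "s \<in> Len (repeat_mset K B)"
        "t \<in> Len (repeat_mset K B)"
      using d(2) by (auto simp: D_def)
    moreover from this have "t = Suc s" by simp
    ultimately show ?thesis by blast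
  qed
  then obtain M where M: "\<And>B. extremal B \<Longrightarrow> filled M B" using extremal_filled by blast
  show ?thesis
  proof (intro exI[of _ "2 * M"] ballI impI)
    fix L assume "L \<in> length_system H" and eq: "ereal (set_elasticity L) = elasticity H"
    then obtain B where "L = Len B" "B \<in> carrier (zero_sum_monoid G)" unfolding sys by blast
    with carrier_iff have B: "L = Len B" "Len B \<noteq> {}" by metis+
    \<comment> \<open>For nonempty \<open>B\<close> this is \<open>extremal_iff\<close>; the empty
      sequence is extremal anyway.\<close>
    have "extremal B"
      using extremal_iff[OF B(2)] eq extremal_empty unfolding B(1) by metis
    then have filled: "filled M B" by (rule M)
    show "\<exists>(y::int) (l::nat) (L'::int set) (L''::int set).
       L' \<subseteq> {- int (2 * M) .. -1} \<and>
       L'' \<subseteq> (+) (int l) ` {1 .. int (2 * M)} \<and>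
       int ` L = (+) y ` (L' \<union> {0 .. int l} \<union> L'')"
      unfolding B(1)
      by (rule interval_decomposition[OF finite_Len B(2)]) (use filled in \<open>simp add: filled_def\<close>)
  qed
qed

end
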